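(* Let $(C,S^\downarrow,S^\uparrow)$ be a biaction. Then it is an $\uparrow\downarrow$-biaction if and only if the following hold for all $c,d,e\in C$, all $s,u\in S^\downarrow$, all $t,v\in S^\uparrow$, and all finite words $w$ (possibly empty) in elements of $S^\downarrow$ and $S^\uparrow$: (i) (idempotence) $css=cs$ and $ctt=ct$; (ii) (previous redundance) $csts=cts$ and $ctst=cst$; (iii) (commutativity in $S^\downarrow$ and in $S^\uparrow$) $csu=cus$ and $ctv=cvt$; (iv) (basic and extra subset axioms) if $csw=dsw$ and $ctw=dtw$ and $esw=etw$, then $cw=dw$.
   Context: A biaction $(C,S^\downarrow,S^\uparrow)$ consists of three sets and two functions $f\colon C\times S^\downarrow\to C$ and $g\colon C\times S^\uparrow\to C$; write $cs$ for $f(c,s)$ and $ct$ for $g(c,t)$. It is regarded as a three-sorted algebra; homomorphisms, subalgebras and isomorphisms are those of three-sorted algebras. For a finite word $w=x_1\cdots x_k$ with each $x_i$ in $S^\downarrow$ or $S^\uparrow$, $cw=(\cdots((cx_1)x_2)\cdots)x_k$ (and $cw=c$ for $w$ empty). For a set $X$, the full $\uparrow\downarrow$-biaction $F(X)$ on $X$ has $C=S^\downarrow=S^\uparrow=\mathcal{P}(X)$, with $cs=c\cap s$ for $c\in C$, $s\in S^\downarrow$, and $ct=c\cup t$ for $c\in C$, $t\in S^\uparrow$. A biaction is an $\uparrow\downarrow$-biaction if it is isomorphic to a subalgebra of $F(X)$ for some set $X$. *)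

theory Defs
  imports Main
begin

record ('c, 's, 't) biaction =
  states :: "'c set"
  downs :: "'s set"
  ups :: "'t set"
  act_down :: "'c \<Rightarrow> 's \<Rightarrow> 'c" (infixl "\<down>\<index>" 70)
  act_up :: "'c \<Rightarrow> 't \<Rightarrow> 'c" (infixl "\<up>\<index>" 70)

text \<open>Any of the three sorts may be empty; the values of the two actions outside the sorts are
  irrelevant.\<close>

definition biaction :: "('c, 's, 't) biaction \<Rightarrow> bool" where
  "biaction B \<longleftrightarrow>
     (\<forall>c\<in>states B. \<forall>s\<in>downs B. c \<down>\<^bsub>B\<^esub> s \<in> states B) \<and>
     (\<forall>c\<in>states B. \<forall>t\<in>ups B. c \<up>\<^bsub>B\<^esub> t \<in> states B)"

definition biaction_hom ::
  "('c, 's, 't) biaction \<Rightarrow> ('c2, 's2, 't2) biaction \<Rightarrow>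
   ('c \<Rightarrow> 'c2) \<Rightarrow> ('s \<Rightarrow> 's2) \<Rightarrow> ('t \<Rightarrow> 't2) \<Rightarrow> bool" where
  "biaction_hom A B f g h \<longleftrightarrow>
     f ` states A \<subseteq> states B \<and> g ` downs A \<subseteq> downs B \<and> h ` ups A \<subseteq> ups B \<and>
     (\<forall>c\<in>states A. \<forall>s\<in>downs A. f (c \<down>\<^bsub>A\<^esub> s) = f c \<down>\<^bsub>B\<^esub> g s) \<and>
     (\<forall>c\<in>states A. \<forall>t\<in>ups A. f (c \<up>\<^bsub>A\<^esub> t) = f c \<up>\<^bsub>B\<^esub> h t)"

definition biaction_isomorphic ::
  "('c, 's, 't) biaction \<Rightarrow> ('c2, 's2, 't2) biaction \<Rightarrow> bool" where
  "biaction_isomorphic A B \<longleftrightarrow>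
     (\<exists>f g h. biaction_hom A B f g h \<and> bij_betw f (states A) (states B) \<and>
        bij_betw g (downs A) (downs B) \<and> bij_betw h (ups A) (ups B))"

definition subbiaction :: "('c, 's, 't) biaction \<Rightarrow> ('c, 's, 't) biaction \<Rightarrow> bool" where
  "subbiaction A B \<longleftrightarrow>
     biaction A \<and> states A \<subseteq> states B \<and> downs A \<subseteq> downs B \<and> ups A \<subseteq> ups B \<and>
     (\<forall>c\<in>states A. \<forall>s\<in>downs A. c \<down>\<^bsub>A\<^esub> s = c \<down>\<^bsub>B\<^esub> s) \<and>
     (\<forall>c\<in>states A. \<forall>t\<in>ups A. c \<up>\<^bsub>A\<^esub> t = c \<up>\<^bsub>B\<^esub> t)"

definition full_biaction :: "'x set \<Rightarrow> ('x set, 'x set, 'x set) biaction" where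
  "full_biaction X =
     \<lparr>states = Pow X, downs = Pow X, ups = Pow X, act_down = (\<inter>), act_up = (\<union>)\<rparr>"

text \<open>HOL cannot quantify over sets \<open>X\<close> of elements of an unspecified type, so the type
  \<open>'x\<close> of the elements of \<open>X\<close> is a parameter.  Up to isomorphism of subalgebras, a point
  of \<open>X\<close> only matters through the states, downs and ups whose images contain it, so the type
  \<open>'c set \<times> 's set \<times> 't set\<close> is large enough to represent every such biaction; that no
  other type admits more is part of the theorem, not an assumption.\<close>

definition updown_biaction :: "'x itself \<Rightarrow> ('c, 's, 't) biaction \<Rightarrow> bool" where
  "updown_biaction ty B \<longleftrightarrow>
     (\<exists>(X :: 'x set) A. subbiaction A (full_biaction X) \<and> biaction_isomorphic B A)"

text \<open>Letters are tagged with their sort, since the two sorts need not be disjoint: \<open>Inl s\<close> acts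
  from \<open>downs\<close> and \<open>Inr t\<close> from \<open>ups\<close>.\<close>

definition word_act :: "('c, 's, 't) biaction \<Rightarrow> 'c \<Rightarrow> ('s + 't) list \<Rightarrow> 'c" where
  "word_act B c w =
     foldl (\<lambda>d x. case x of Inl s \<Rightarrow> d \<down>\<^bsub>B\<^esub> s | Inr t \<Rightarrow> d \<up>\<^bsub>B\<^esub> t) c w"

end

theory Submission
  imports Defs
begin

text \<open>
  A point of \<open>X\<close> enters a subalgebra of the full biaction on \<open>X\<close> only through the states, downs
  and ups that contain it, that is, through a triple \<open>(P, Q, R)\<close> with \<open>cs \<in> P\<close> iff
  \<open>c \<in> P \<and> s \<in> Q\<close>, and \<open>ct \<in> P\<close> iff \<open>c \<in> P \<or> t \<in> R\<close>.  Call such a triple a point of the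
  biaction.  Taking all points at once as the underlying set, a biaction is representable iff any
  two distinct states are separated by a point (\<open>updown_imp_separated\<close>,
  \<open>separated_imp_updown\<close>); distinct downs and distinct ups can always be separated, even when they
  act alike.  Separation does not mention \<open>X\<close>, so a representation over any type of elements
  yields one by triples.

  With respect to a point each letter either preserves membership in \<open>P\<close> or makes it constant, and
  hence so does each word.  The axioms can therefore be checked one point at a time.

  Conversely, let the axioms hold and let \<open>c \<noteq> d\<close>.  The equational axioms say that a word depends
  only on the last occurrences of its letters, so that \<open>c v w = c w\<close> whenever the letters of \<open>v\<close>
  occur in \<open>w\<close> (\<open>run_absorb\<close>).  For a set \<open>M\<close> of letters, identify two states when some word
  over \<open>M\<close> sends them to the same state.  By the absorption law this is a congruence for all
  letters, and letters of \<open>M\<close> act trivially modulo it.  Zorn's lemma gives a maximal \<open>M\<close> which does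
  not identify \<open>c\<close> with \<open>d\<close>; by maximality every letter outside \<open>M\<close> does identify \<open>c\<close> with
  \<open>d\<close>.  The point sought has \<open>M\<close> as its set of preserving letters: all values \<open>es\<close> with
  \<open>s \<notin> M\<close> must lie outside \<open>P\<close> and all values \<open>et\<close> with \<open>t \<notin> M\<close> inside.  Axiom (iv) says
  exactly that no class is required to be both.  Commutativity shows that \<open>c\<close> and \<open>d\<close> are not both
  forced inside and not both forced outside, so that one of them can be put on each side.
\<close>

section \<open>Points and representations\<close>

text \<open>Membership in \<open>P\<close>, \<open>Q\<close> and \<open>R\<close> is the trace, on the three sorts, of one element of a
  representing set.\<close>

definition is_point :: "('c, 's, 't) biaction \<Rightarrow> 'c set \<Rightarrow> 's set \<Rightarrow> 't set \<Rightarrow> bool" where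
  "is_point B P Q R \<longleftrightarrow>
     (\<forall>c\<in>states B. \<forall>s\<in>downs B. c \<down>\<^bsub>B\<^esub> s \<in> P \<longleftrightarrow> c \<in> P \<and> s \<in> Q) \<and>
     (\<forall>c\<in>states B. \<forall>t\<in>ups B. c \<up>\<^bsub>B\<^esub> t \<in> P \<longleftrightarrow> c \<in> P \<or> t \<in> R)"

definition separated :: "('c, 's, 't) biaction \<Rightarrow> bool" where
  "separated B \<longleftrightarrow>
     (\<forall>c\<in>states B. \<forall>d\<in>states B. c \<noteq> d \<longrightarrow>
        (\<exists>P Q R. is_point B P Q R \<and> (c \<in> P) \<noteq> (d \<in> P)))"

lemma separated_eqI:
  assumes "separated B" "c \<in> states B" "d \<in> states B"
    and "\<And>P Q R. is_point B P Q R \<Longrightarrow> c \<in> P \<longleftrightarrow> d \<in> P"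
  shows "c = d"
  using assms unfolding separated_def by blast

lemma updown_imp_separated:
  assumes "updown_biaction TYPE('x) B"
  shows "separated B"
proof -
  obtain X :: "'x set" and A where sub: "subbiaction A (full_biaction X)"
    and "biaction_isomorphic B A"
    using assms unfolding updown_biaction_def by (elim exE conjE)
  then obtain f g h where hom: "biaction_hom B A f g h" and "bij_betw f (states B) (states A)"
    unfolding biaction_isomorphic_def by (elim exE conjE)
  then have inj: "inj_on f (states B)"
    by (simp add: bij_betw_def)
  have down: "f (c \<down>\<^bsub>B\<^esub> s) = f c \<inter> g s" if "c \<in> states B" "s \<in> downs B" for c s
    using sub hom that
    by (auto simp: subbiaction_def biaction_hom_def full_biaction_def image_subset_iff)
  have up: "f (c \<up>\<^bsub>B\<^esub> t) = f c \<union> h t" if "c \<in> states B" "t \<in> ups B" for c t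
    using sub hom that
    by (auto simp: subbiaction_def biaction_hom_def full_biaction_def image_subset_iff)
  have point: "is_point B {c. x \<in> f c} {s. x \<in> g s} {t. x \<in> h t}" for x
    by (auto simp: is_point_def down up)
  show ?thesis
    unfolding separated_def
  proof (intro ballI impI)
    fix c d assume "c \<in> states B" "d \<in> states B" "c \<noteq> d"
    then have "f c \<noteq> f d"
      using inj by (auto dest: inj_onD)
    then obtain x where x: "(x \<in> f c) \<noteq> (x \<in> f d)" by blast
    show "\<exists>P Q R. is_point B P Q R \<and> (c \<in> P) \<noteq> (d \<in> P)"
      by (intro exI conjI, rule point[of x]) (use x in simp)
  qed
qed

lemma separated_imp_updown:
  fixes B :: "('c, 's, 't) biaction"
  assumes B: "biaction B" and sep: "separated B"
  shows "updown_biaction TYPE('c set \<times> 's set \<times> 't set) B"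
proof -
  define X where "X = {(P, Q, R). is_point B P Q R}"
  define f where "f c = {(P, Q, R). is_point B P Q R \<and> c \<in> P}" for c
  define g where "g s = {(P, Q, R). is_point B P Q R \<and> s \<in> Q}" for s
  define h where "h t = {(P, Q, R). is_point B P Q R \<and> t \<in> R}" for t
  define A where "A = \<lparr>states = f ` states B, downs = g ` downs B, ups = h ` ups B,
    act_down = (\<inter>), act_up = (\<union>)\<rparr>"
  have down: "f (c \<down>\<^bsub>B\<^esub> s) = f c \<inter> g s" if "c \<in> states B" "s \<in> downs B" for c s
    using that by (auto simp: f_def g_def is_point_def)
  have up: "f (c \<up>\<^bsub>B\<^esub> t) = f c \<union> h t" if "c \<in> states B" "t \<in> ups B" for c t
    using that by (auto simp: f_def h_def is_point_def)
  have "inj_on f (states B)"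
  proof (rule inj_onI)
    fix c d assume "c \<in> states B" "d \<in> states B" and eq: "f c = f d"
    then show "c = d"
      by (intro separated_eqI[OF sep]) (auto simp: f_def set_eq_iff)
  qed
  \<comment> \<open>A point in no state and no up may lie in an arbitrary set of downs.\<close>
  moreover have "inj_on g (downs B)"
  proof (rule inj_onI)
    fix s u assume "g s = g u"
    moreover have "({}, {s}, {}) \<in> g s"
      by (simp add: g_def is_point_def)
    ultimately show "s = u"
      by (auto simp: g_def)
  qed
  \<comment> \<open>Dually, a point in all states and all downs may lie in an arbitrary set of ups.\<close>
  moreover have "inj_on h (ups B)"
  proof (rule inj_onI)
    fix t v assume "h t = h v"
    moreover have "(UNIV, UNIV, {t}) \<in> h t"
      by (simp add: h_def is_point_def)
    ultimately show "t = v"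
      by (auto simp: h_def)
  qed
  moreover have "biaction_hom B A f g h"
    by (auto simp: biaction_hom_def A_def down up)
  ultimately have iso: "biaction_isomorphic B A"
    unfolding biaction_isomorphic_def bij_betw_def by (auto simp: A_def)
  have "biaction A"
    using B by (auto simp: biaction_def A_def simp flip: down up)
  moreover have "f c \<in> Pow X" "g s \<in> Pow X" "h t \<in> Pow X" for c s t
    by (auto simp: X_def f_def g_def h_def)
  then have "states A \<subseteq> Pow X" "downs A \<subseteq> Pow X" "ups A \<subseteq> Pow X"
    by (simp_all add: A_def image_subset_iff del: Pow_iff)
  moreover have "act_down A = (\<inter>)" "act_up A = (\<union>)"
    by (simp_all add: A_def)
  ultimately have "subbiaction A (full_biaction X)"
    by (simp add: subbiaction_def full_biaction_def)
  with iso show ?thesis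
    unfolding updown_biaction_def by (intro exI[of _ X] exI[of _ A] conjI)
qed

section \<open>Points satisfy the axioms\<close>

abbreviation letters :: "('c, 's, 't) biaction \<Rightarrow> ('s + 't) set" where
  "letters B \<equiv> downs B <+> ups B"

lemma word_act_simps [simp]:
  "word_act B c [] = c"
  "word_act B c (Inl s # w) = word_act B (c \<down>\<^bsub>B\<^esub> s) w"
  "word_act B c (Inr t # w) = word_act B (c \<up>\<^bsub>B\<^esub> t) w"
  by (simp_all add: word_act_def)

lemma biaction_closed:
  assumes "biaction B" "c \<in> states B"
  shows "s \<in> downs B \<Longrightarrow> c \<down>\<^bsub>B\<^esub> s \<in> states B" "t \<in> ups B \<Longrightarrow> c \<up>\<^bsub>B\<^esub> t \<in> states B"
  using assms by (auto simp: biaction_def)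

lemma word_act_closed:
  assumes "biaction B" "w \<in> lists (letters B)" "c \<in> states B"
  shows "word_act B c w \<in> states B"
  using assms(2,3)
  by (induction w arbitrary: c) (auto simp: biaction_closed[OF assms(1)])

lemma point_word_cases:
  assumes B: "biaction B" and point: "is_point B P Q R" and w: "w \<in> lists (letters B)"
  obtains (preserves) "\<And>c. c \<in> states B \<Longrightarrow> word_act B c w \<in> P \<longleftrightarrow> c \<in> P"
  | (const) b where "\<And>c. c \<in> states B \<Longrightarrow> word_act B c w \<in> P \<longleftrightarrow> b"
proof -
  have "(\<forall>c\<in>states B. word_act B c w \<in> P \<longleftrightarrow> c \<in> P) \<or>
        (\<exists>b. \<forall>c\<in>states B. word_act B c w \<in> P \<longleftrightarrow> b)"
    using w
  proof (induction w)
    case (Cons x w)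
    have "(\<forall>c\<in>states B. word_act B c w \<in> P \<longleftrightarrow> c \<in> P) \<or>
          (\<exists>b. \<forall>c\<in>states B. word_act B c w \<in> P \<longleftrightarrow> b)"
      using Cons by blast
    then show ?case
    proof
      assume "\<forall>c\<in>states B. word_act B c w \<in> P \<longleftrightarrow> c \<in> P"
      with Cons.hyps point show ?thesis
        by (cases x) (auto simp: is_point_def biaction_closed[OF B])
    next
      assume "\<exists>b. \<forall>c\<in>states B. word_act B c w \<in> P \<longleftrightarrow> b"
      then obtain b where b: "word_act B c w \<in> P \<longleftrightarrow> b" if "c \<in> states B" for c
        by blast
      have "word_act B c (x # w) \<in> P \<longleftrightarrow> b" if "c \<in> states B" for c
        using Cons.hyps that by (cases x) (auto simp: biaction_closed[OF B] b)
      then show ?thesis by blast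
    qed
  qed simp
  with that show thesis by blast
qed

text \<open>A word that is constant at the point makes the conclusion trivial, and one that preserves
  membership can be dropped.  Then the first premise suffices if the point lies in \<open>s\<close>, the second
  if it is not in \<open>t\<close>, and otherwise the third premise fails, since \<open>es\<close> misses the point and
  \<open>et\<close> contains it.\<close>

lemma separated_subset_axiom:
  assumes B: "biaction B" and sep: "separated B"
    and cde: "c \<in> states B" "d \<in> states B" "e \<in> states B"
    and st: "s \<in> downs B" "t \<in> ups B" and w: "w \<in> lists (letters B)"
    and eqs: "word_act B (c \<down>\<^bsub>B\<^esub> s) w = word_act B (d \<down>\<^bsub>B\<^esub> s) w"
      "word_act B (c \<up>\<^bsub>B\<^esub> t) w = word_act B (d \<up>\<^bsub>B\<^esub> t) w"
      "word_act B (e \<down>\<^bsub>B\<^esub> s) w = word_act B (e \<up>\<^bsub>B\<^esub> t) w"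
  shows "word_act B c w = word_act B d w"
proof (rule separated_eqI[OF sep])
  fix P Q R assume point: "is_point B P Q R"
  from B point w show "word_act B c w \<in> P \<longleftrightarrow> word_act B d w \<in> P"
  proof (cases rule: point_word_cases)
    case preserves
    have "c \<down>\<^bsub>B\<^esub> s \<in> P \<longleftrightarrow> d \<down>\<^bsub>B\<^esub> s \<in> P" "c \<up>\<^bsub>B\<^esub> t \<in> P \<longleftrightarrow> d \<up>\<^bsub>B\<^esub> t \<in> P"
      "e \<down>\<^bsub>B\<^esub> s \<in> P \<longleftrightarrow> e \<up>\<^bsub>B\<^esub> t \<in> P"
      using eqs preserves cde st by (metis biaction_closed[OF B])+
    then have "c \<in> P \<longleftrightarrow> d \<in> P"
      using point cde st by (auto simp: is_point_def)
    then show ?thesis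
      using preserves cde by simp
  qed (use cde in simp)
qed (use word_act_closed[OF B w] cde in auto)

section \<open>Collapsing a set of letters\<close>

text \<open>The identity \<open>xyx = yx\<close> defines right regular bands.  Here it arises from previous redundance
  for letters of different sorts, and from idempotence and commutativity for letters of the same
  sort.\<close>

locale right_regular_action =
  fixes C :: "'c set" and A :: "'a set" and act :: "'c \<Rightarrow> 'a \<Rightarrow> 'c"
  assumes closed: "c \<in> C \<Longrightarrow> x \<in> A \<Longrightarrow> act c x \<in> C"
    and idem: "c \<in> C \<Longrightarrow> x \<in> A \<Longrightarrow> act (act c x) x = act c x"
    and regular: "c \<in> C \<Longrightarrow> x \<in> A \<Longrightarrow> y \<in> A \<Longrightarrow>
      act (act (act c x) y) x = act (act c y) x"
begin

abbreviation run :: "'c \<Rightarrow> 'a list \<Rightarrow> 'c" where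
  "run \<equiv> foldl act"

lemma run_closed: "w \<in> lists A \<Longrightarrow> c \<in> C \<Longrightarrow> run c w \<in> C"
  by (induction w arbitrary: c) (auto simp: closed)

lemma run_absorb_letter:
  assumes "w \<in> lists A" "x \<in> A" "c \<in> C" "x \<in> set w"
  shows "run (act c x) w = run c w"
  using assms
proof (induction w rule: rev_induct)
  case (snoc y w)
  show ?case
  proof (cases "x \<in> set w")
    case True
    with snoc show ?thesis by auto
  next
    case False
    with snoc.prems have [simp]: "y = x" by auto
    \<comment> \<open>Only the final letter is known to be \<open>x\<close>; the identity copies it backwards through \<open>w\<close>.\<close>
    have "act (run (act c x) v) x = act (run c v) x" if "v \<in> lists A" for v
      using that
    proof (induction v rule: rev_induct)
      case Nil
      then show ?case using idem snoc.prems by simp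
    next
      case (snoc z v)
      have "z \<in> A" "run c v \<in> C" "run (act c x) v \<in> C"
        using snoc.prems \<open>x \<in> A\<close> \<open>c \<in> C\<close> by (auto simp: run_closed closed)
      then show ?case
        using snoc regular[OF _ \<open>x \<in> A\<close>, of _ z] by (metis append_in_lists_conv foldl.simps foldl_append)
    qed
    with snoc.prems show ?thesis by auto
  qed
qed simp

lemma run_absorb:
  assumes "w \<in> lists A" "c \<in> C" "set v \<subseteq> set w"
  shows "run (run c v) w = run c w"
  using assms(2,3)
proof (induction v arbitrary: c)
  case (Cons x v)
  then have "x \<in> A" using assms(1) by auto
  with Cons assms(1) show ?case by (simp add: closed run_absorb_letter)
qed simp

lemma run_eq_mono:
  assumes "run a v = run b v" "w \<in> lists A" "a \<in> C" "b \<in> C" "set v \<subseteq> set w"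
  shows "run a w = run b w"
  using assms by (metis run_absorb)

definition collapse :: "'a set \<Rightarrow> 'c \<Rightarrow> 'c \<Rightarrow> bool" where
  "collapse M a b \<longleftrightarrow> (\<exists>w\<in>lists M. run a w = run b w)"

lemma collapse_refl [simp]: "collapse M a a"
  unfolding collapse_def by (intro bexI[of _ "[]"]) auto

lemma collapse_sym: "collapse M a b \<Longrightarrow> collapse M b a"
  unfolding collapse_def by metis

context
  fixes M assumes M: "M \<subseteq> A"
begin

lemma collapse_trans:
  assumes "collapse M a b" "collapse M b c" and C: "a \<in> C" "b \<in> C" "c \<in> C"
  shows "collapse M a c"
proof -
  obtain v w where vw: "v \<in> lists M" "w \<in> lists M" "run a v = run b v" "run b w = run c w"
    using assms unfolding collapse_def by blast
  then have "v @ w \<in> lists A" using M by auto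
  with vw C have "run a (v @ w) = run b (v @ w)" "run b (v @ w) = run c (v @ w)"
    using run_eq_mono[of a v b "v @ w"] run_eq_mono[of b w c "v @ w"]
    by (simp_all del: foldl_append)
  with vw show ?thesis
    unfolding collapse_def by (metis append_in_lists_conv)
qed

text \<open>If \<open>w\<close> identifies \<open>a\<close> and \<open>b\<close>, then so does \<open>xw\<close>, which has all letters of \<open>w\<close>; and this
  means that \<open>w\<close> identifies \<open>ax\<close> and \<open>bx\<close>.  The letter \<open>x\<close> may lie outside \<open>M\<close>.\<close>

lemma collapse_act:
  assumes "collapse M a b" "a \<in> C" "b \<in> C" "x \<in> A"
  shows "collapse M (act a x) (act b x)"
proof -
  obtain w where w: "w \<in> lists M" "run a w = run b w"
    using assms unfolding collapse_def by blast
  then have "x # w \<in> lists A" using M \<open>x \<in> A\<close> by auto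
  with w assms have "run a (x # w) = run b (x # w)"
    using run_eq_mono[of a w b "x # w"] by auto
  with w show ?thesis
    unfolding collapse_def by auto
qed

lemma collapse_act_self:
  assumes "x \<in> M" "a \<in> C"
  shows "collapse M (act a x) a"
  unfolding collapse_def using assms M idem by (intro bexI[of _ "[x]"]) auto

end

text \<open>That no word over \<open>M\<close> identifies \<open>c\<close> and \<open>d\<close> is a property of finite character, so Zorn's
  lemma applies.  If \<open>x\<close> cannot be added to \<open>M\<close>, some word over \<open>insert x M\<close> identifies
  \<open>c\<close> with \<open>d\<close>, and by \<open>run_eq_mono\<close> so does the word with all \<open>x\<close> gathered at the front.\<close>

lemma maximal_collapse:
  assumes cd: "c \<in> C" "d \<in> C" "c \<noteq> d"
  obtains M where "M \<subseteq> A" "\<not> collapse M c d"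
    "\<And>x. x \<in> A - M \<Longrightarrow> collapse M (act c x) (act d x)"
proof -
  define F where "F = {M. M \<subseteq> A \<and> \<not> collapse M c d}"
  have "{} \<in> F"
    using cd by (auto simp: F_def collapse_def)
  moreover have "\<Union>K \<in> F" if K: "K \<noteq> {}" "subset.chain F K" for K
  proof -
    have "\<not> collapse (\<Union>K) c d"
    proof
      assume "collapse (\<Union>K) c d"
      then obtain w where w: "set w \<subseteq> \<Union>K" "run c w = run d w"
        unfolding collapse_def by auto
      then obtain M where "M \<in> K" "set w \<subseteq> M"
        using finite_subset_Union_chain[of "set w" K F] K by auto
      with w K show False
        unfolding F_def collapse_def subset.chain_def by (auto simp: lists_eq_set)
    qed
    then show ?thesis
      using K by (auto simp: F_def subset.chain_def)
  qed
  ultimately obtain M where M: "M \<in> F" and max: "\<And>N. N \<in> F \<Longrightarrow> M \<subseteq> N \<Longrightarrow> N = M"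
    using subset_Zorn_nonempty[of F] by blast
  have "collapse M (act c x) (act d x)" if x: "x \<in> A - M" for x
  proof -
    have "insert x M \<notin> F"
      using max[of "insert x M"] x by auto
    then obtain w where w: "w \<in> lists (insert x M)" "run c w = run d w"
      using M x by (auto simp: F_def collapse_def)
    let ?w = "removeAll x w"
    have "?w \<in> lists M" using w by auto
    moreover from this have "x # ?w \<in> lists A" "set w \<subseteq> set (x # ?w)"
      using M x by (auto simp: F_def)
    then have "run c (x # ?w) = run d (x # ?w)"
      using w cd by (intro run_eq_mono[of c w d "x # ?w"])
    ultimately show ?thesis
      unfolding collapse_def by auto
  qed
  with M that show thesis by (auto simp: F_def)
qed

end

section \<open>The axioms provide enough points\<close>

text \<open>The congruence is that of a maximal \<open>M\<close> which keeps \<open>c\<close> and \<open>d\<close> apart.  By idempotence, the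
  values of a letter are, modulo the congruence, its fixed points.  The states \<open>In\<close> fixed by some up
  outside \<open>M\<close> are thus those that a point with preserving letters \<open>M\<close> must contain, and the states
  \<open>Out\<close> fixed by some down outside \<open>M\<close> are those that it must avoid.\<close>

lemma axioms_imp_separated:
  assumes B: "biaction B"
    and idem_down: "\<And>c s. c \<in> states B \<Longrightarrow> s \<in> downs B \<Longrightarrow> c \<down>\<^bsub>B\<^esub> s \<down>\<^bsub>B\<^esub> s = c \<down>\<^bsub>B\<^esub> s"
    and idem_up: "\<And>c t. c \<in> states B \<Longrightarrow> t \<in> ups B \<Longrightarrow> c \<up>\<^bsub>B\<^esub> t \<up>\<^bsub>B\<^esub> t = c \<up>\<^bsub>B\<^esub> t"
    and redundant: "\<And>c s t. c \<in> states B \<Longrightarrow> s \<in> downs B \<Longrightarrow> t \<in> ups B \<Longrightarrow>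
         c \<down>\<^bsub>B\<^esub> s \<up>\<^bsub>B\<^esub> t \<down>\<^bsub>B\<^esub> s = c \<up>\<^bsub>B\<^esub> t \<down>\<^bsub>B\<^esub> s"
      "\<And>c s t. c \<in> states B \<Longrightarrow> s \<in> downs B \<Longrightarrow> t \<in> ups B \<Longrightarrow>
         c \<up>\<^bsub>B\<^esub> t \<down>\<^bsub>B\<^esub> s \<up>\<^bsub>B\<^esub> t = c \<down>\<^bsub>B\<^esub> s \<up>\<^bsub>B\<^esub> t"
    and comm_down: "\<And>c s u. c \<in> states B \<Longrightarrow> s \<in> downs B \<Longrightarrow> u \<in> downs B \<Longrightarrow>
         c \<down>\<^bsub>B\<^esub> s \<down>\<^bsub>B\<^esub> u = c \<down>\<^bsub>B\<^esub> u \<down>\<^bsub>B\<^esub> s"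
    and comm_up: "\<And>c t v. c \<in> states B \<Longrightarrow> t \<in> ups B \<Longrightarrow> v \<in> ups B \<Longrightarrow>
         c \<up>\<^bsub>B\<^esub> t \<up>\<^bsub>B\<^esub> v = c \<up>\<^bsub>B\<^esub> v \<up>\<^bsub>B\<^esub> t"
    and subset_axiom: "\<And>c d e s t w. c \<in> states B \<Longrightarrow> d \<in> states B \<Longrightarrow> e \<in> states B \<Longrightarrow>
         s \<in> downs B \<Longrightarrow> t \<in> ups B \<Longrightarrow> w \<in> lists (letters B) \<Longrightarrow>
         word_act B (c \<down>\<^bsub>B\<^esub> s) w = word_act B (d \<down>\<^bsub>B\<^esub> s) w \<Longrightarrow>
         word_act B (c \<up>\<^bsub>B\<^esub> t) w = word_act B (d \<up>\<^bsub>B\<^esub> t) w \<Longrightarrow>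
         word_act B (e \<down>\<^bsub>B\<^esub> s) w = word_act B (e \<up>\<^bsub>B\<^esub> t) w \<Longrightarrow>
         word_act B c w = word_act B d w"
  shows "separated B"
  unfolding separated_def
proof (intro ballI impI)
  fix c d assume cd: "c \<in> states B" "d \<in> states B" "c \<noteq> d"
  define act where "act a x = (case x of Inl s \<Rightarrow> a \<down>\<^bsub>B\<^esub> s | Inr t \<Rightarrow> a \<up>\<^bsub>B\<^esub> t)" for a x
  have act_simps: "act a (Inl s) = a \<down>\<^bsub>B\<^esub> s" "act a (Inr t) = a \<up>\<^bsub>B\<^esub> t" for a s t
    by (simp_all add: act_def)
  have word_act_eq: "word_act B a w = foldl act a w" for a w
    by (simp add: word_act_def act_def[abs_def])
  note mem = biaction_closed[OF B]
  interpret right_regular_action "states B" "letters B" act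
  proof
    fix a x y assume a: "a \<in> states B" and x: "x \<in> letters B" and y: "y \<in> letters B"
    show "act (act (act a x) y) x = act (act a y) x"
    proof (cases "isl x = isl y")
      case True
      then have "act (act a x) y = act (act a y) x" "act (act (act a y) x) x = act (act a y) x"
        using a x y comm_down comm_up idem_down idem_up
        by (auto simp: act_simps mem)
      then show ?thesis by simp
    qed (use a x y redundant in \<open>auto simp: act_simps\<close>)
  qed (auto simp: act_simps mem idem_down idem_up)
  obtain M where M: "M \<subseteq> letters B" and cd_M: "\<not> collapse M c d"
    and max: "\<And>x. x \<in> letters B - M \<Longrightarrow> collapse M (act c x) (act d x)"
    using maximal_collapse cd by metis
  note sym = collapse_sym and trans = collapse_trans[OF M]
  note cong = collapse_act[OF M] and fixed = collapse_act_self[OF M]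
  define In where
    "In = {a \<in> states B. \<exists>t\<in>ups B. Inr t \<notin> M \<and> collapse M (a \<up>\<^bsub>B\<^esub> t) a}"
  define Out where
    "Out = {a \<in> states B. \<exists>s\<in>downs B. Inl s \<notin> M \<and> collapse M (a \<down>\<^bsub>B\<^esub> s) a}"
  have saturated: "collapse M (act b x) b"
    if "collapse M (act a x) a" "collapse M a b" "a \<in> states B" "b \<in> states B" "x \<in> letters B"
    for a b x
    by (meson that closed cong sym trans)
  have In_saturated: "b \<in> In" if "a \<in> In" "collapse M a b" "b \<in> states B" for a b
    using that saturated[of a "Inr t" b for t] by (auto simp: In_def act_simps)
  have Out_saturated: "b \<in> Out" if "a \<in> Out" "collapse M a b" "b \<in> states B" for a b
    using that saturated[of a "Inl s" b for s] by (auto simp: Out_def act_simps)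

  have disjoint: "a \<notin> Out" if "a \<in> In" for a
  proof
    assume "a \<in> Out"
    then obtain s t where a: "a \<in> states B" and s: "s \<in> downs B" "Inl s \<notin> M"
      and t: "t \<in> ups B" "Inr t \<notin> M"
      and "collapse M (a \<down>\<^bsub>B\<^esub> s) a" "collapse M (a \<up>\<^bsub>B\<^esub> t) a"
      using \<open>a \<in> In\<close> by (auto simp: In_def Out_def)
    then have "collapse M (a \<down>\<^bsub>B\<^esub> s) (a \<up>\<^bsub>B\<^esub> t)"
      by (meson mem sym trans)
    moreover have "collapse M (c \<down>\<^bsub>B\<^esub> s) (d \<down>\<^bsub>B\<^esub> s)" "collapse M (c \<up>\<^bsub>B\<^esub> t) (d \<up>\<^bsub>B\<^esub> t)"
      using max[of "Inl s"] max[of "Inr t"] s t by (auto simp: act_simps)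
    ultimately obtain w1 w2 w3 where w: "w1 \<in> lists M" "w2 \<in> lists M" "w3 \<in> lists M"
      and eqs: "run (a \<down>\<^bsub>B\<^esub> s) w1 = run (a \<up>\<^bsub>B\<^esub> t) w1"
        "run (c \<down>\<^bsub>B\<^esub> s) w2 = run (d \<down>\<^bsub>B\<^esub> s) w2" "run (c \<up>\<^bsub>B\<^esub> t) w3 = run (d \<up>\<^bsub>B\<^esub> t) w3"
      unfolding collapse_def by blast
    \<comment> \<open>The axiom needs one word for its three premises.\<close>
    define w where "w = w1 @ w2 @ w3"
    have wM: "w \<in> lists M" and wA: "w \<in> lists (letters B)"
      using w M by (auto simp: w_def)
    have sub: "set w1 \<subseteq> set w" "set w2 \<subseteq> set w" "set w3 \<subseteq> set w"
      by (auto simp: w_def)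
    have "run c w = run d w"
      using subset_axiom[OF cd(1,2) a s(1) t(1) wA]
        run_eq_mono[OF eqs(1) wA _ _ sub(1)] run_eq_mono[OF eqs(2) wA _ _ sub(2)]
        run_eq_mono[OF eqs(3) wA _ _ sub(3)] mem a s t cd
      unfolding word_act_eq by simp
    with wM cd_M show False
      unfolding collapse_def by blast
  qed

  \<comment> \<open>With \<open>\<sim>\<close> for the congruence, \<open>c \<sim> cx \<sim> dx \<sim> dyx = dxy \<sim> cxy \<sim> cy \<sim> dy \<sim> d\<close>.\<close>
  have not_both: False
    if x: "x \<in> letters B - M" and y: "y \<in> letters B - M"
      and cx: "collapse M (act c x) c" and dy: "collapse M (act d y) d"
      and comm: "act (act d y) x = act (act d x) y" for x y
  proof -
    have C: "act c x \<in> states B" "act d x \<in> states B" "act c y \<in> states B" "act d y \<in> states B"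
      "act (act d x) y \<in> states B" "act (act c x) y \<in> states B"
      using cd x y by (simp_all add: closed)
    have "collapse M c (act d x)"
      using sym[OF cx] max[OF x] trans C cd by blast
    moreover have "collapse M (act d x) (act (act d x) y)"
      using cong[OF sym[OF dy], of x] x C cd comm by simp
    moreover have "collapse M (act (act d x) y) (act (act c x) y)"
      using cong[OF sym[OF max[OF x]], of y] y C cd by simp
    moreover have "collapse M (act (act c x) y) (act c y)"
      using cong[OF cx, of y] y C cd by simp
    moreover have "collapse M (act c y) d"
      using max[OF y] dy trans C cd by blast
    ultimately have "collapse M c d"
      using C cd by (meson trans)
    with cd_M show False ..
  qed
  have not_both_In: "\<not> (c \<in> In \<and> d \<in> In)"
  proof
    assume "c \<in> In \<and> d \<in> In"
    then obtain t v where "t \<in> ups B" "Inr t \<notin> M" "collapse M (c \<up>\<^bsub>B\<^esub> t) c"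
      and "v \<in> ups B" "Inr v \<notin> M" "collapse M (d \<up>\<^bsub>B\<^esub> v) d"
      by (auto simp: In_def)
    then show False
      using not_both[of "Inr t" "Inr v"] comm_up cd by (simp add: act_simps InrI)
  qed
  have not_both_Out: "\<not> (c \<in> Out \<and> d \<in> Out)"
  proof
    assume "c \<in> Out \<and> d \<in> Out"
    then obtain s u where "s \<in> downs B" "Inl s \<notin> M" "collapse M (c \<down>\<^bsub>B\<^esub> s) c"
      and "u \<in> downs B" "Inl u \<notin> M" "collapse M (d \<down>\<^bsub>B\<^esub> u) d"
      by (auto simp: Out_def)
    then show False
      using not_both[of "Inl s" "Inl u"] comm_down cd by (simp add: act_simps InlI)
  qed

  obtain y z where yz: "{y, z} = {c, d}" and y: "y \<notin> In" and z: "z \<notin> Out"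
    using not_both_In not_both_Out disjoint by (metis insert_commute)
  have z_C: "z \<in> states B" and yz_M: "\<not> collapse M y z"
    using yz cd cd_M sym by (auto simp: doubleton_eq_iff)
  define P where "P = In \<union> {a \<in> states B. collapse M a z}"
  have P_saturated: "a \<in> P \<longleftrightarrow> b \<in> P"
    if "collapse M a b" "a \<in> states B" "b \<in> states B" for a b
    unfolding P_def using that In_saturated sym trans z_C by blast
  have P_Out: "a \<notin> P" if "a \<in> Out" for a
    using that disjoint Out_saturated[of a z] z z_C by (auto simp: P_def)
  have "is_point B P {s. Inl s \<in> M} {t. Inr t \<notin> M}"
    unfolding is_point_def
  proof (intro conjI ballI)
    fix a s assume a: "a \<in> states B" and s: "s \<in> downs B"
    show "a \<down>\<^bsub>B\<^esub> s \<in> P \<longleftrightarrow> a \<in> P \<and> s \<in> {s. Inl s \<in> M}"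
    proof (cases "Inl s \<in> M")
      case True
      then show ?thesis
        using P_saturated[OF _ mem(1)[OF a s] a] fixed[of "Inl s" a] a by (simp add: act_simps)
    next
      case False
      then have "a \<down>\<^bsub>B\<^esub> s \<in> Out"
        using a s mem idem_down unfolding Out_def by force
      with False P_Out show ?thesis by simp
    qed
  next
    fix a t assume a: "a \<in> states B" and t: "t \<in> ups B"
    show "a \<up>\<^bsub>B\<^esub> t \<in> P \<longleftrightarrow> a \<in> P \<or> t \<in> {t. Inr t \<notin> M}"
    proof (cases "Inr t \<in> M")
      case True
      then show ?thesis
        using P_saturated[OF _ mem(2)[OF a t] a] fixed[of "Inr t" a] a by (simp add: act_simps)
    next
      case False
      then have "a \<up>\<^bsub>B\<^esub> t \<in> In"
        using a t mem idem_up unfolding In_def by force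
      with False show ?thesis by (simp add: P_def)
    qed
  qed
  moreover have "z \<in> P" "y \<notin> P"
    using y z_C yz_M by (auto simp: P_def)
  then have "(c \<in> P) \<noteq> (d \<in> P)"
    using yz by (auto simp: doubleton_eq_iff)
  ultimately show "\<exists>P Q R. is_point B P Q R \<and> (c \<in> P) \<noteq> (d \<in> P)"
    by (intro exI conjI)
qed

section \<open>Characterization\<close>

theorem theorem5p6:
  fixes B :: "('c, 's, 't) biaction"
  assumes "biaction B"
  shows "(updown_biaction TYPE('c set \<times> 's set \<times> 't set) B \<longleftrightarrow>
      (\<forall>c\<in>states B. \<forall>s\<in>downs B. c \<down>\<^bsub>B\<^esub> s \<down>\<^bsub>B\<^esub> s = c \<down>\<^bsub>B\<^esub> s) \<and>
      (\<forall>c\<in>states B. \<forall>t\<in>ups B. c \<up>\<^bsub>B\<^esub> t \<up>\<^bsub>B\<^esub> t = c \<up>\<^bsub>B\<^esub> t) \<and>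
      (\<forall>c\<in>states B. \<forall>s\<in>downs B. \<forall>t\<in>ups B.
         c \<down>\<^bsub>B\<^esub> s \<up>\<^bsub>B\<^esub> t \<down>\<^bsub>B\<^esub> s = c \<up>\<^bsub>B\<^esub> t \<down>\<^bsub>B\<^esub> s \<and>
         c \<up>\<^bsub>B\<^esub> t \<down>\<^bsub>B\<^esub> s \<up>\<^bsub>B\<^esub> t = c \<down>\<^bsub>B\<^esub> s \<up>\<^bsub>B\<^esub> t) \<and>
      (\<forall>c\<in>states B. \<forall>s\<in>downs B. \<forall>u\<in>downs B.
         c \<down>\<^bsub>B\<^esub> s \<down>\<^bsub>B\<^esub> u = c \<down>\<^bsub>B\<^esub> u \<down>\<^bsub>B\<^esub> s) \<and>
      (\<forall>c\<in>states B. \<forall>t\<in>ups B. \<forall>v\<in>ups B.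
         c \<up>\<^bsub>B\<^esub> t \<up>\<^bsub>B\<^esub> v = c \<up>\<^bsub>B\<^esub> v \<up>\<^bsub>B\<^esub> t) \<and>
      (\<forall>c\<in>states B. \<forall>d\<in>states B. \<forall>e\<in>states B. \<forall>s\<in>downs B. \<forall>t\<in>ups B.
         \<forall>w\<in>lists (downs B <+> ups B).
         word_act B (c \<down>\<^bsub>B\<^esub> s) w = word_act B (d \<down>\<^bsub>B\<^esub> s) w \<longrightarrow>
         word_act B (c \<up>\<^bsub>B\<^esub> t) w = word_act B (d \<up>\<^bsub>B\<^esub> t) w \<longrightarrow>
         word_act B (e \<down>\<^bsub>B\<^esub> s) w = word_act B (e \<up>\<^bsub>B\<^esub> t) w \<longrightarrow>
         word_act B c w = word_act B d w)) \<and>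
    (updown_biaction TYPE('x) B \<longrightarrow>
       updown_biaction TYPE('c set \<times> 's set \<times> 't set) B)"

proof (intro conjI impI iffI)
  assume "updown_biaction TYPE('c set \<times> 's set \<times> 't set) B"
  then have sep: "separated B"
    by (rule updown_imp_separated)
  note mem = biaction_closed[OF assms]
  show "\<forall>c\<in>states B. \<forall>s\<in>downs B. c \<down>\<^bsub>B\<^esub> s \<down>\<^bsub>B\<^esub> s = c \<down>\<^bsub>B\<^esub> s"
    by (intro ballI separated_eqI[OF sep]) (auto simp: mem is_point_def)
  show "\<forall>c\<in>states B. \<forall>t\<in>ups B. c \<up>\<^bsub>B\<^esub> t \<up>\<^bsub>B\<^esub> t = c \<up>\<^bsub>B\<^esub> t"
    by (intro ballI separated_eqI[OF sep]) (auto simp: mem is_point_def)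
  show "\<forall>c\<in>states B. \<forall>s\<in>downs B. \<forall>t\<in>ups B.
         c \<down>\<^bsub>B\<^esub> s \<up>\<^bsub>B\<^esub> t \<down>\<^bsub>B\<^esub> s = c \<up>\<^bsub>B\<^esub> t \<down>\<^bsub>B\<^esub> s \<and>
         c \<up>\<^bsub>B\<^esub> t \<down>\<^bsub>B\<^esub> s \<up>\<^bsub>B\<^esub> t = c \<down>\<^bsub>B\<^esub> s \<up>\<^bsub>B\<^esub> t"
    by (intro ballI conjI separated_eqI[OF sep]) (auto simp: mem is_point_def)
  show "\<forall>c\<in>states B. \<forall>s\<in>downs B. \<forall>u\<in>downs B.
         c \<down>\<^bsub>B\<^esub> s \<down>\<^bsub>B\<^esub> u = c \<down>\<^bsub>B\<^esub> u \<down>\<^bsub>B\<^esub> s"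
    by (intro ballI separated_eqI[OF sep]) (auto simp: mem is_point_def)
  show "\<forall>c\<in>states B. \<forall>t\<in>ups B. \<forall>v\<in>ups B.
         c \<up>\<^bsub>B\<^esub> t \<up>\<^bsub>B\<^esub> v = c \<up>\<^bsub>B\<^esub> v \<up>\<^bsub>B\<^esub> t"
    by (intro ballI separated_eqI[OF sep]) (auto simp: mem is_point_def)
  show "\<forall>c\<in>states B. \<forall>d\<in>states B. \<forall>e\<in>states B. \<forall>s\<in>downs B. \<forall>t\<in>ups B.
         \<forall>w\<in>lists (downs B <+> ups B).
         word_act B (c \<down>\<^bsub>B\<^esub> s) w = word_act B (d \<down>\<^bsub>B\<^esub> s) w \<longrightarrow>
         word_act B (c \<up>\<^bsub>B\<^esub> t) w = word_act B (d \<up>\<^bsub>B\<^esub> t) w \<longrightarrow>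
         word_act B (e \<down>\<^bsub>B\<^esub> s) w = word_act B (e \<up>\<^bsub>B\<^esub> t) w \<longrightarrow>
         word_act B c w = word_act B d w"
    by (intro ballI impI) (rule separated_subset_axiom[OF assms sep])
next
  assume "updown_biaction TYPE('x) B"
  then have "separated B"
    by (rule updown_imp_separated)
  then show "updown_biaction TYPE('c set \<times> 's set \<times> 't set) B"
    by (rule separated_imp_updown[OF assms])
qed (rule separated_imp_updown[OF assms], rule axioms_imp_separated[OF assms], blast+)

end
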